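(* Let $V$ be a finite nonempty set, $n\in\mathbb{R}$, $H_n=\{q\in\mathbb{R}^V:\sum_{v\in V}q(v)=n\}$, and let $\mathscr{C}$ be a family of supermodular functions $\mu\colon2^V\to\mathbb{R}$ of range $\mu(V)=n$, with support $\mathbf{P}_{\mathscr{C}}:=\bigcup_{\mu\in\mathscr{C}}\mathbf{P}_\mu$. Let $\Omega$ be a connected open subset of $H_n$. Assume $\mathbf{P}_{\mathscr{C}}$ intersects $\Omega$. If $\mathscr{C}$ is complete for $\Omega$ and positive, then $\mathbf{P}_{\mathscr{C}}\supseteq\Omega$.
   Context: A function $\mu\colon 2^V\to\mathbb{R}$ is supermodular if $\mu(\emptyset)=0$ and $\mu(I_1)+\mu(I_2)\le\mu(I_1\cup I_2)+\mu(I_1\cap I_2)$ for all $I_1,I_2\subseteq V$. Its adjoint is $\mu^*(I):=\mu(V)-\mu(V\setminus I)$. For $q\in\mathbb{R}^V$ put $q(I)=\sum_{v\in I}q(v)$. The base polytope of $\mu$ is $\mathbf{P}_\mu:=\{q\in\mathbb{R}^V:\mu(I)\le q(I)\le\mu^*(I)\ \forall I\subseteq V\}\subset H_{\mu(V)}$. A bipartition of $V$ is an ordered pair $\pi=(I,J)$ of disjoint nonempty subsets with union $V$; put $\pi^c=(J,I)$. The splitting of $\mu$ with respect to $\pi$ is $\mu_\pi(S):=\mu(S\cap I)+\mu(S\cup I)-\mu(I)$; it is supermodular of the same range as $\mu$. The function $\mu$ is simple if $\mu(I)+\mu(J)<\mu(V)$ for each bipartition $(I,J)$ of $V$ (equivalently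 $\mu\ne\mu_\pi$ for every bipartition $\pi$). The spread of $\mu$ is the minimum of $\mu^*(I)-\mu(I)$ over nonempty proper subsets $I\subset V$ (by convention zero if $|V|=1$). The family $\mathscr{C}$ is complete for $\Omega$ if for each $\mu\in\mathscr{C}$ and each bipartition $\pi$ of $V$ such that $\mathbf{P}_{\mu_\pi}$ intersects $\Omega$, there is $\mu'\in\mathscr{C}$ distinct from $\mu_\pi$ such that $\mu'_{\pi^c}=\mu_\pi$. The family $\mathscr{C}$ is positive if it contains simple elements and the infimum of the spreads of its simple elements is positive. *)

theory Defs
  imports "HOL-Analysis.Analysis"
begin

text \<open>
  The finite nonempty ground set $V$ is the universe of a type \<open>'v::finite\<close>, so that
  $\mathbb{R}^V$ is \<^typ>\<open>real ^ 'v\<close> and set functions $2^V \to \mathbb{R}$ are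
  of type \<^typ>\<open>'v set \<Rightarrow> real\<close>.
\<close>

definition supermodular :: "('v::finite set \<Rightarrow> real) \<Rightarrow> bool" where
  "supermodular \<mu> \<longleftrightarrow>
     \<mu> {} = 0 \<and> (\<forall>I J. \<mu> I + \<mu> J \<le> \<mu> (I \<union> J) + \<mu> (I \<inter> J))"

definition range_val :: "('v::finite set \<Rightarrow> real) \<Rightarrow> real" where
  "range_val \<mu> = \<mu> UNIV"

definition adjoint_fun :: "('v::finite set \<Rightarrow> real) \<Rightarrow> 'v set \<Rightarrow> real" where
  "adjoint_fun \<mu> I = \<mu> UNIV - \<mu> (UNIV - I)"

definition vec_sum :: "real ^ 'v::finite \<Rightarrow> 'v set \<Rightarrow> real" where
  "vec_sum q I = (\<Sum>v\<in>I. q $ v)"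

definition sum_hyperplane :: "real \<Rightarrow> (real ^ 'v::finite) set" where
  "sum_hyperplane n = {q. (\<Sum>v\<in>UNIV. q $ v) = n}"

definition base_polytope :: "('v::finite set \<Rightarrow> real) \<Rightarrow> (real ^ 'v) set" where
  "base_polytope \<mu> = {q. \<forall>I. \<mu> I \<le> vec_sum q I \<and> vec_sum q I \<le> adjoint_fun \<mu> I}"

definition bipartition :: "'v::finite set \<times> 'v set \<Rightarrow> bool" where
  "bipartition \<pi> \<longleftrightarrow>
     fst \<pi> \<noteq> {} \<and> snd \<pi> \<noteq> {} \<and> fst \<pi> \<inter> snd \<pi> = {} \<and> fst \<pi> \<union> snd \<pi> = UNIV"

definition opposite :: "'v::finite set \<times> 'v set \<Rightarrow> 'v set \<times> 'v set" where
  "opposite \<pi> = (snd \<pi>, fst \<pi>)"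

definition splitting ::
  "('v::finite set \<Rightarrow> real) \<Rightarrow> 'v set \<times> 'v set \<Rightarrow> 'v set \<Rightarrow> real" where
  "splitting \<mu> \<pi> S = \<mu> (S \<inter> fst \<pi>) + \<mu> (S \<union> fst \<pi>) - \<mu> (fst \<pi>)"

definition simple :: "('v::finite set \<Rightarrow> real) \<Rightarrow> bool" where
  "simple \<mu> \<longleftrightarrow> (\<forall>I J. bipartition (I, J) \<longrightarrow> \<mu> I + \<mu> J < \<mu> UNIV)"

definition spread :: "('v::finite set \<Rightarrow> real) \<Rightarrow> real" where
  "spread \<mu> =
     (if CARD('v) = 1 then 0
      else Min {adjoint_fun \<mu> I - \<mu> I | I. I \<noteq> {} \<and> I \<noteq> UNIV})"

definition support :: "('v::finite set \<Rightarrow> real) set \<Rightarrow> (real ^ 'v) set" where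
  "support \<C> = (\<Union>\<mu>\<in>\<C>. base_polytope \<mu>)"

definition complete_for ::
  "('v::finite set \<Rightarrow> real) set \<Rightarrow> (real ^ 'v) set \<Rightarrow> bool" where
  "complete_for \<C> \<Omega> \<longleftrightarrow>
     (\<forall>\<mu>\<in>\<C>. \<forall>\<pi>. bipartition \<pi> \<longrightarrow> base_polytope (splitting \<mu> \<pi>) \<inter> \<Omega> \<noteq> {} \<longrightarrow>
        (\<exists>\<mu>'\<in>\<C>. \<mu>' \<noteq> splitting \<mu> \<pi> \<and> splitting \<mu>' (opposite \<pi>) = splitting \<mu> \<pi>))"

text \<open>
  For a family of supermodular functions the spreads of the simple elements are
  nonnegative, so the real-valued \<open>Inf\<close> below is taken over a nonempty set that is
  bounded below and is the genuine infimum.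
\<close>

definition positive_family :: "('v::finite set \<Rightarrow> real) set \<Rightarrow> bool" where
  "positive_family \<C> \<longleftrightarrow>
     (\<exists>\<mu>\<in>\<C>. simple \<mu>) \<and> 0 < (INF \<mu>\<in>{\<mu> \<in> \<C>. simple \<mu>}. spread \<mu>)"

end

theory Submission
  imports Defs
begin

text \<open>
  The support is shown to be invariant under motion inside $\Omega$ along the root directions
  $e_a - e_b$. These directions span the linear hyperplane parallel to $H_n$, so near any of its
  points $\Omega$ is connected by short zigzags in root directions (\<open>root_path\<close>), and
  connectedness of $\Omega$ does the rest.

  To move from $x \in \mathbf{P}_\mu$ in the direction $e_a - e_b$ with $\mu$ simple, follow the
  segment until it leaves $\mathbf{P}_\mu$. At the exit point some inequality
  $q(I) \ge \mu(I)$ with $b \in I$, $a \notin I$ is an equality, and completeness yields a function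
  $\mu'$ whose polytope lies on the other side of that face. By choosing $I$ well
  (\<open>facet_set_exists\<close>) the new function is again simple (\<open>crosses_to_simple\<close>),
  and the walk goes on from $\mathbf{P}_{\mu'}$.

  The point is that such a walk cannot cross infinitely many faces on a bounded segment
  (\<open>no_infinite_walk\<close>). The polytopes of the family may overlap and may have arbitrarily
  short edges, so neither a volume count nor local finiteness bounds the walk. Instead, let $q$ be the
  limit point of the walk, let $I_k$ be the sets that are crossed, and let $W$ be the set of the
  elements that lie in $I_k$ for all large $k$. It contains $b$ and not $a$, hence is a
  nonempty proper subset of $V$. Submodularity of the slacks $q(S) - \mu_k(S)$, together with the
  relations across each face (\<open>crosses_lower\<close>, \<open>crosses_eq\<close>), propagates the tightness of the $I_k$ backwards to finite intersections of them, and the tightness of their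
  complements forwards to finite unions, without accumulation of errors. So, for some late $k$, both
  $W$ and its complement are almost tight for the same $\mu_k$. That bounds
  $\mu_k^*(W) - \mu_k(W)$ by an arbitrarily small number, against the positivity of the spreads.
\<close>

section \<open>Slacks\<close>

definition slack :: "('v::finite set \<Rightarrow> real) \<Rightarrow> real ^ 'v \<Rightarrow> 'v set \<Rightarrow> real" where
  "slack \<mu> q S = vec_sum q S - \<mu> S"

lemma vec_sum_Un_Int:
  "vec_sum q (S \<union> T) + vec_sum q (S \<inter> T) = vec_sum q S + vec_sum q T"
  unfolding vec_sum_def by (rule sum.union_inter) auto

lemma vec_sum_Compl: "vec_sum q S + vec_sum q (- S) = vec_sum q UNIV"
  using vec_sum_Un_Int[of q S "- S"] by (simp add: vec_sum_def)

lemma supermodularD: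
  assumes "supermodular \<mu>"
  shows "\<mu> {} = 0" "\<mu> S + \<mu> T \<le> \<mu> (S \<union> T) + \<mu> (S \<inter> T)"
  using assms by (auto simp: supermodular_def)

lemma supermodular_Compl_le:
  assumes "supermodular \<mu>"
  shows "\<mu> S + \<mu> (- S) \<le> \<mu> UNIV"
  using supermodularD[OF assms] by (metis Compl_disjoint Compl_partition add.right_neutral)

lemma slack_empty: "supermodular \<mu> \<Longrightarrow> slack \<mu> q {} = 0"
  by (simp add: slack_def supermodularD vec_sum_def)

lemma slack_submodular:
  assumes "supermodular \<mu>"
  shows "slack \<mu> q (S \<union> T) + slack \<mu> q (S \<inter> T) \<le> slack \<mu> q S + slack \<mu> q T"
  using supermodularD(2)[OF assms, of S T] vec_sum_Un_Int[of q S T] by (simp add: slack_def)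

lemma slack_Compl:
  "slack \<mu> q S + slack \<mu> q (- S) = slack \<mu> q UNIV + (\<mu> UNIV - \<mu> S - \<mu> (- S))"
  using vec_sum_Compl[of q S] by (simp add: slack_def)

lemma mem_base_polytope_iff:
  assumes "supermodular \<mu>"
  shows "q \<in> base_polytope \<mu> \<longleftrightarrow> slack \<mu> q UNIV = 0 \<and> (\<forall>S. 0 \<le> slack \<mu> q S)"
proof
  assume q: "q \<in> base_polytope \<mu>"
  have "vec_sum q UNIV \<le> \<mu> UNIV" "\<mu> UNIV \<le> vec_sum q UNIV"
    using q supermodularD(1)[OF assms]
    by (auto simp: base_polytope_def adjoint_fun_def dest: spec[of _ UNIV])
  then show "slack \<mu> q UNIV = 0 \<and> (\<forall>S. 0 \<le> slack \<mu> q S)"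
    using q by (auto simp: slack_def base_polytope_def)
next
  assume *: "slack \<mu> q UNIV = 0 \<and> (\<forall>S. 0 \<le> slack \<mu> q S)"
  show "q \<in> base_polytope \<mu>"
    unfolding base_polytope_def adjoint_fun_def
  proof (clarify, intro conjI)
    fix S
    show "\<mu> S \<le> vec_sum q S" using * by (auto simp: slack_def)
    have "0 \<le> slack \<mu> q (- S)" using * by blast
    then show "vec_sum q S \<le> \<mu> UNIV - \<mu> (UNIV - S)"
      using * vec_sum_Compl[of q S] unfolding slack_def Compl_eq_Diff_UNIV by linarith
  qed
qed

section \<open>Splittings, simple functions and spreads\<close>

text \<open>
  Passing to a splitting can only raise the values, which is why the polytope of a splitting lies in
  the original one, and why the two functions on both sides of a face are bounded by their common
  splitting.
\<close>

lemma le_splitting: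
  assumes "supermodular \<mu>"
  shows "\<mu> S \<le> splitting \<mu> (I, J) S"
  using supermodularD(2)[OF assms, of S I] by (simp add: splitting_def)

lemma splitting_eq_self:
  assumes "supermodular \<mu>" and "\<mu> I + \<mu> (- I) = \<mu> UNIV"
  shows "splitting \<mu> (I, J) = \<mu>"
proof
  fix S
  have "\<mu> (S \<union> I) + \<mu> (- I) \<le> \<mu> ((S \<union> I) \<union> - I) + \<mu> ((S \<union> I) \<inter> - I)"
    by (rule supermodularD(2)[OF assms(1)])
  moreover have "(S \<union> I) \<union> - I = UNIV" "(S \<union> I) \<inter> - I = S - I" by auto
  ultimately have 1: "\<mu> (S \<union> I) + \<mu> (- I) \<le> \<mu> UNIV + \<mu> (S - I)" by simp
  have "\<mu> (S \<inter> I) + \<mu> (S - I) \<le> \<mu> ((S \<inter> I) \<union> (S - I)) + \<mu> ((S \<inter> I) \<inter> (S - I))"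
    by (rule supermodularD(2)[OF assms(1)])
  moreover have "(S \<inter> I) \<union> (S - I) = S" "(S \<inter> I) \<inter> (S - I) = {}" by auto
  ultimately have 2: "\<mu> (S \<inter> I) + \<mu> (S - I) \<le> \<mu> S"
    using supermodularD(1)[OF assms(1)] by simp
  show "splitting \<mu> (I, J) S = \<mu> S"
    using 1 2 assms(2) le_splitting[OF assms(1), of S I J] by (simp add: splitting_def)
qed

lemma bipartition_iff:
  "bipartition (I, J) \<longleftrightarrow> J = - I \<and> I \<noteq> {} \<and> I \<noteq> UNIV"
  by (auto simp: bipartition_def)

lemma simple_iff:
  "simple \<mu> \<longleftrightarrow> (\<forall>I. I \<noteq> {} \<longrightarrow> I \<noteq> UNIV \<longrightarrow> \<mu> I + \<mu> (- I) < \<mu> UNIV)"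
  by (auto simp: simple_def bipartition_iff)

lemma not_simpleE:
  assumes "supermodular \<mu>" and "\<not> simple \<mu>"
  obtains I where "I \<noteq> {}" "I \<noteq> UNIV" "\<mu> I + \<mu> (- I) = \<mu> UNIV"
  using assms supermodular_Compl_le[OF assms(1)]
  by (metis (no_types, lifting) order_le_less simple_iff)

lemma spread_le:
  fixes \<mu> :: "'v::finite set \<Rightarrow> real"
  assumes "I \<noteq> {}" "I \<noteq> UNIV"
  shows "spread \<mu> \<le> \<mu> UNIV - \<mu> I - \<mu> (- I)"
proof -
  have "CARD('v) \<noteq> 1"
    using assms by (metis UNIV_I card_1_singletonE singletonD subset_singletonD top_greatest)
  moreover have "adjoint_fun \<mu> I - \<mu> I \<in> {adjoint_fun \<mu> I - \<mu> I | I. I \<noteq> {} \<and> I \<noteq> UNIV}"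
    using assms by blast
  ultimately have "spread \<mu> \<le> adjoint_fun \<mu> I - \<mu> I"
    unfolding spread_def by (simp add: Min_le)
  then show ?thesis by (simp add: adjoint_fun_def Compl_eq_Diff_UNIV)
qed

lemma spread_nonneg:
  fixes \<mu> :: "'v::finite set \<Rightarrow> real"
  assumes "supermodular \<mu>"
  shows "0 \<le> spread \<mu>"
proof (cases "CARD('v) = 1")
  case False
  let ?M = "{adjoint_fun \<mu> I - \<mu> I | I. I \<noteq> {} \<and> I \<noteq> UNIV}"
  obtain v :: 'v where "v \<in> UNIV" by blast
  have "{v} \<noteq> UNIV"
  proof
    assume "{v} = UNIV"
    then have "CARD('v) = card {v}" by simp
    with False show False by simp
  qed
  then have "?M \<noteq> {}" by blast
  moreover have "finite ?M" by simp
  moreover have "0 \<le> y" if "y \<in> ?M" for y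
  proof -
    from that obtain I where "y = adjoint_fun \<mu> I - \<mu> I" by auto
    then show ?thesis
      using supermodular_Compl_le[OF assms, of I]
      by (simp add: adjoint_fun_def Compl_eq_Diff_UNIV)
  qed
  ultimately show ?thesis using False by (simp add: spread_def)
qed (simp add: spread_def)

text \<open>
  Spreads are nonnegative, so the infimum in the definition of positivity is a lower bound for each
  of them. For a singleton ground set the spread is zero, but then there is no nonempty proper
  subset.
\<close>

lemma positive_family_width:
  fixes \<C> :: "('v::finite set \<Rightarrow> real) set"
  assumes "\<And>\<mu>. \<mu> \<in> \<C> \<Longrightarrow> supermodular \<mu>" and "positive_family \<C>"
  obtains \<epsilon> where "0 < \<epsilon>"
    "\<And>\<mu> I. \<mu> \<in> \<C> \<Longrightarrow> simple \<mu> \<Longrightarrow> I \<noteq> {} \<Longrightarrow> I \<noteq> UNIV \<Longrightarrow>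
      \<epsilon> \<le> \<mu> UNIV - \<mu> I - \<mu> (- I)"
proof
  let ?X = "{\<mu> \<in> \<C>. simple \<mu>}"
  show "0 < (INF \<mu>\<in>?X. spread \<mu>)" using assms(2) by (simp add: positive_family_def)
  have "bdd_below (spread ` ?X)"
    using assms(1) by (intro bdd_belowI2[of _ 0]) (auto intro: spread_nonneg)
  then show "(INF \<mu>\<in>?X. spread \<mu>) \<le> \<mu> UNIV - \<mu> I - \<mu> (- I)"
    if "\<mu> \<in> \<C>" "simple \<mu>" "I \<noteq> {}" "I \<noteq> UNIV" for \<mu> I
    using cINF_lower[of spread ?X \<mu>] that spread_le[of I \<mu>] by force
qed

section \<open>Crossing a face\<close>

text \<open>
  The polytopes of \<open>\<mu>\<close> and \<open>\<mu>'\<close> share the face on which \<open>I\<close> is tight for \<open>\<mu>\<close>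
  and the complement of \<open>I\<close> is tight for \<open>\<mu>'\<close>; they lie on opposite sides of the
  hyperplane that carries it.
\<close>

definition crosses ::
  "('v::finite set \<Rightarrow> real) \<Rightarrow> 'v set \<Rightarrow> ('v set \<Rightarrow> real) \<Rightarrow> bool" where
  "crosses \<mu> I \<mu>' \<longleftrightarrow> splitting \<mu>' (- I, I) = splitting \<mu> (I, - I)"

text \<open>
  After a crossing, the slack of any set is controlled by the old slacks of two sets comparable
  to \<open>I\<close>, because \<open>\<mu>'\<close> is bounded by the common splitting. This carries tightness for
  \<open>\<mu>'\<close> back to tightness for \<open>\<mu>\<close>.
\<close>

lemma crosses_lower:
  assumes "supermodular \<mu>'" "crosses \<mu> I \<mu>'"
  shows "slack \<mu> q (S \<inter> I) + slack \<mu> q (S \<union> I) - slack \<mu> q I \<le> slack \<mu>' q S"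
proof -
  have "\<mu>' S \<le> splitting \<mu> (I, - I) S"
    using le_splitting[OF assms(1), of S "- I" I] assms(2) by (simp add: crosses_def)
  then show ?thesis
    using vec_sum_Un_Int[of q S I] by (simp add: slack_def splitting_def)
qed

text \<open>
  On the subsets and supersets of the set on which one splits, a splitting is an affine copy of the
  function itself. Hence on the supersets of the complement of \<open>I\<close> the new slacks are
  determined by the old ones, and tightness is carried forward too.
\<close>

lemma crosses_eq:
  assumes "supermodular \<mu>" "supermodular \<mu>'" "\<mu>' UNIV = \<mu> UNIV" "crosses \<mu> I \<mu>'"
    and "slack \<mu> q UNIV = 0" "S \<subseteq> I"
  shows "slack \<mu>' q (S \<union> - I) = slack \<mu> q S - slack \<mu> q I"
proof -
  have eq: "splitting \<mu>' (- I, I) T = splitting \<mu> (I, - I) T" for T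
    using assms(4) by (simp add: crosses_def)
  have e: "\<mu>' {} = 0" "\<mu> {} = 0" using assms(1,2) by (auto simp: supermodularD)
  have "\<mu>' (- I) = \<mu> UNIV - \<mu> I"
    using eq[of I] e assms(3) by (simp add: splitting_def)
  moreover have "S \<inter> - I = {}" "S \<union> I = I" "S \<inter> I = S" using assms(6) by auto
  ultimately have "\<mu>' (S \<union> - I) = \<mu> S + \<mu> UNIV - \<mu> I"
    using eq[of S] e by (simp add: splitting_def)
  moreover have "vec_sum q (S \<union> - I) = vec_sum q S + vec_sum q (- I)"
    using vec_sum_Un_Int[of q S "- I"] \<open>S \<inter> - I = {}\<close> by (simp add: vec_sum_def)
  ultimately show ?thesis
    using assms(5) vec_sum_Compl[of q I] by (simp add: slack_def)
qed

lemma mem_base_polytope_crosses: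
  assumes "supermodular \<mu>" "supermodular \<mu>'" "\<mu>' UNIV = \<mu> UNIV" "crosses \<mu> I \<mu>'"
    and "q \<in> base_polytope \<mu>" "slack \<mu> q I = 0"
  shows "q \<in> base_polytope \<mu>'"
proof -
  have "0 \<le> slack \<mu>' q S" for S
    using crosses_lower[OF assms(2,4), of q S] assms(5,6)
    unfolding mem_base_polytope_iff[OF assms(1)] by (smt (verit))
  moreover have "slack \<mu>' q UNIV = 0"
    using assms(3,5) unfolding mem_base_polytope_iff[OF assms(1)] by (simp add: slack_def)
  ultimately show ?thesis unfolding mem_base_polytope_iff[OF assms(2)] by blast
qed

lemma mem_base_polytope_splitting:
  assumes "supermodular \<mu>" "q \<in> base_polytope \<mu>" "slack \<mu> q I = 0"
  shows "q \<in> base_polytope (splitting \<mu> (I, - I))"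
proof -
  let ?\<sigma> = "splitting \<mu> (I, - I)"
  have s: "slack ?\<sigma> q S = slack \<mu> q (S \<inter> I) + slack \<mu> q (S \<union> I) - slack \<mu> q I" for S
    using vec_sum_Un_Int[of q S I] by (simp add: slack_def splitting_def)
  have nn: "0 \<le> slack ?\<sigma> q S" for S
    unfolding s using assms(2,3) unfolding mem_base_polytope_iff[OF assms(1)] by simp
  have z: "slack ?\<sigma> q UNIV = 0"
    unfolding s using assms(2,3) unfolding mem_base_polytope_iff[OF assms(1)] by simp
  have e: "?\<sigma> {} = 0" using supermodularD(1)[OF assms(1)] by (simp add: splitting_def)
  show ?thesis
    unfolding base_polytope_def adjoint_fun_def
  proof (clarify, intro conjI)
    fix S
    show "?\<sigma> S \<le> vec_sum q S" using nn[of S] by (simp add: slack_def)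
    show "vec_sum q S \<le> ?\<sigma> UNIV - ?\<sigma> (UNIV - S)"
      using nn[of "- S"] z vec_sum_Compl[of q S]
      by (simp add: slack_def Compl_eq_Diff_UNIV)
  qed
qed

lemma complete_forE:
  assumes "complete_for \<C> \<Omega>" "\<mu> \<in> \<C>" "supermodular \<mu>"
    and "q \<in> base_polytope \<mu>" "q \<in> \<Omega>" "slack \<mu> q I = 0" "I \<noteq> {}" "I \<noteq> UNIV"
  obtains \<mu>' where "\<mu>' \<in> \<C>" "crosses \<mu> I \<mu>'" "\<mu>' \<noteq> splitting \<mu> (I, - I)"
proof -
  have "bipartition (I, - I)" using assms by (simp add: bipartition_iff)
  moreover have "base_polytope (splitting \<mu> (I, - I)) \<inter> \<Omega> \<noteq> {}"
    using mem_base_polytope_splitting[OF assms(3,4,6)] assms(5) by blast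
  ultimately show thesis
    using assms(1,2) that unfolding complete_for_def crosses_def opposite_def by fastforce
qed

text \<open>
  A function that is not simple equals one of its splittings, so completeness can be applied to it
  at the whole of its polytope. The function obtained lies below the given one, so its polytope is
  larger, and it has strictly fewer decompositions; the process ends at a simple function.
\<close>

lemma mem_simple_base_polytope:
  fixes \<C> :: "('v::finite set \<Rightarrow> real) set"
  assumes C: "\<And>\<mu>. \<mu> \<in> \<C> \<Longrightarrow> supermodular \<mu> \<and> \<mu> UNIV = n"
    and comp: "complete_for \<C> \<Omega>" and "q \<in> \<Omega>" and "\<mu> \<in> \<C>" "q \<in> base_polytope \<mu>"
  shows "\<exists>\<nu>\<in>\<C>. simple \<nu> \<and> q \<in> base_polytope \<nu>"
  using assms(4,5)
proof (induction "card {A. \<mu> A + \<mu> (- A) = n}" arbitrary: \<mu> rule: less_induct)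
  case less
  note sm = C[OF less.prems(1)]
  show ?case
  proof (cases "simple \<mu>")
    case False
    then obtain I where I: "I \<noteq> {}" "I \<noteq> UNIV" "\<mu> I + \<mu> (- I) = n"
      using sm not_simpleE by metis
    have nn: "slack \<mu> q UNIV = 0" "0 \<le> slack \<mu> q S" for S
      using less.prems(2) mem_base_polytope_iff sm by blast+
    have t: "slack \<mu> q I = 0"
      using slack_Compl[of \<mu> q I] nn(1) nn(2)[of I] nn(2)[of "- I"] I(3) sm by linarith
    obtain \<mu>' where \<mu>': "\<mu>' \<in> \<C>" "crosses \<mu> I \<mu>'" "\<mu>' \<noteq> splitting \<mu> (I, - I)"
      using complete_forE[OF comp less.prems(1) _ less.prems(2) assms(3) t I(1,2)] sm by blast
    note sm' = C[OF \<mu>'(1)]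
    have eq: "splitting \<mu>' (- I, I) = \<mu>" "\<mu>' \<noteq> \<mu>"
      using \<mu>'(2,3) splitting_eq_self[of \<mu> I "- I"] sm I(3) by (auto simp: crosses_def)
    have le: "\<mu>' S \<le> \<mu> S" for S
      using le_splitting[of \<mu>' S "- I" I] sm' eq by simp
    have "{A. \<mu>' A + \<mu>' (- A) = n} \<subset> {A. \<mu> A + \<mu> (- A) = n}"
    proof (rule psubsetI)
      show "{A. \<mu>' A + \<mu>' (- A) = n} \<subseteq> {A. \<mu> A + \<mu> (- A) = n}"
      proof
        fix A
        assume "A \<in> {A. \<mu>' A + \<mu>' (- A) = n}"
        then have "\<mu>' A + \<mu>' (- A) = n" by simp
        then have "\<mu> A + \<mu> (- A) = n"
          using le[of A] le[of "- A"] supermodular_Compl_le[of \<mu> A] sm by linarith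
        then show "A \<in> {A. \<mu> A + \<mu> (- A) = n}" by simp
      qed
      have "\<mu>' I + \<mu>' (- I) \<noteq> n"
        using splitting_eq_self[of \<mu>' "- I" I] sm' eq by auto
      with I(3) show "{A. \<mu>' A + \<mu>' (- A) = n} \<noteq> {A. \<mu> A + \<mu> (- A) = n}" by blast
    qed
    then have "card {A. \<mu>' A + \<mu>' (- A) = n} < card {A. \<mu> A + \<mu> (- A) = n}"
      by (intro psubset_card_mono) auto
    moreover have "q \<in> base_polytope \<mu>'"
      using mem_base_polytope_crosses[of \<mu> \<mu>' I q] sm sm' \<mu>'(2) less.prems(2) t by auto
    ultimately show ?thesis using less.hyps \<mu>'(1) by blast
  qed (use less.prems in blast)
qed

section \<open>Crossing facets into simple functions\<close>

text \<open>
  In the application \<open>\<T>\<close> consists of the tight sets at a point of the polytope of a simple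
  function, and the set obtained defines a facet. The conclusion is phrased for the way in which it is
  used: a bipartition that decomposes the function on the other side of \<open>I\<close> would leave the
  traces and unions with \<open>I\<close> in \<open>\<T>\<close>.

  The choice is to take \<open>I\<close> largest among the members that contain \<open>b\<close>, avoid
  \<open>a\<close>, and are not disjoint unions of two nonempty members. Indecomposability forces
  \<open>I\<close> to lie in the part \<open>A\<close> that contains \<open>b\<close>. Of the two remaining pieces of
  the complement of \<open>I\<close>, let \<open>Y\<close> be the one that avoids \<open>a\<close>. By maximality the
  component of \<open>b\<close> in \<open>I \<union> Y\<close> is still \<open>I\<close>, so \<open>Y\<close> is itself a member,
  while its complement, the union of \<open>I\<close> with the other piece, is one too; by
  the hypothesis on complementary members \<open>Y\<close> is then empty.
\<close>

lemma facet_set_exists: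
  fixes \<T> :: "'v::finite set set"
  assumes cup: "\<And>S T. S \<in> \<T> \<Longrightarrow> T \<in> \<T> \<Longrightarrow> S \<union> T \<in> \<T>"
    and cap: "\<And>S T. S \<in> \<T> \<Longrightarrow> T \<in> \<T> \<Longrightarrow> S \<inter> T \<in> \<T>"
    and empty: "{} \<in> \<T>"
    and conn: "\<And>S. S \<in> \<T> \<Longrightarrow> - S \<in> \<T> \<Longrightarrow> S = {} \<or> S = UNIV"
    and I0: "I0 \<in> \<T>" "b \<in> I0" "a \<notin> I0"
  obtains I where "I \<in> \<T>" "b \<in> I" "a \<notin> I"
    "\<And>A. b \<in> A \<Longrightarrow> A \<inter> I \<in> \<T> \<Longrightarrow> A \<union> I \<in> \<T> \<Longrightarrow> - A \<inter> I \<in> \<T> \<Longrightarrow> - A \<union> I \<in> \<T> \<Longrightarrow>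
      A = I \<or> A = UNIV"
proof -
  \<comment> \<open>It suffices to forbid decompositions with b in the first part, since b lies in one of the two.\<close>
  define indec where "indec I \<longleftrightarrow> (\<forall>A. A \<in> \<T> \<longrightarrow> I - A \<in> \<T> \<longrightarrow> A \<subseteq> I \<longrightarrow> b \<in> A \<longrightarrow> A = I)" for I
  define good where "good I \<longleftrightarrow> I \<in> \<T> \<and> b \<in> I \<and> a \<notin> I \<and> indec I" for I
  \<comment> \<open>The component of b in K is the smallest summand of K that contains b. It is needed both
      for an arbitrary K (with I empty, to see that good sets exist at all) and for K above a good I.\<close>
  have component: "\<exists>C. I \<subseteq> C \<and> C \<subseteq> K \<and> good C \<and> K - C \<in> \<T>"
    if K: "K \<in> \<T>" "a \<notin> K" and I: "I \<subseteq> K" "b \<in> K" and ind: "b \<in> I \<Longrightarrow> I \<in> \<T> \<and> indec I"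
      and bI: "I = {} \<or> b \<in> I" for I K
  proof -
    let ?P = "\<lambda>C. b \<in> C \<and> C \<subseteq> K \<and> C \<in> \<T> \<and> K - C \<in> \<T>"
    have "?P K" using K I empty by simp
    then obtain C where C: "?P C" and min: "\<And>C'. ?P C' \<Longrightarrow> card C \<le> card C'"
      using ex_has_least_nat[of ?P K card] by blast
    have "indec C"
      unfolding indec_def
    proof (intro allI impI)
      fix A
      assume A: "A \<in> \<T>" "C - A \<in> \<T>" "A \<subseteq> C" "b \<in> A"
      have "K - A = (C - A) \<union> (K - C)" using A(3) C by blast
      then have "?P A" using A C cup by auto
      then have "card C \<le> card A" by (rule min)
      then show "A = C" using A(3) by (simp add: card_seteq)
    qed
    moreover have "I \<subseteq> C"
    proof (cases "b \<in> I")
      case True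
      then have "I \<inter> C \<in> \<T>" "I - (I \<inter> C) \<in> \<T>"
        using ind C cap[of I C] cap[of I "K - C"] I(1)
        by (auto simp: Diff_Int2 Int_Diff[symmetric] Diff_Int Int_absorb2 dest: eq_refl)
      then show ?thesis using ind True C unfolding indec_def by blast
    qed (use bI in blast)
    ultimately show ?thesis using C K good_def by blast
  qed
  have "\<exists>I. good I" using component[of I0 "{}"] I0 by auto
  then obtain I where I: "good I" and max: "\<And>J. good J \<Longrightarrow> card J \<le> card I"
    using ex_has_greatest_nat[of good _ card "Suc CARD('v)"]
    by (metis card_mono finite le_imp_less_Suc subset_UNIV)
  \<comment> \<open>By maximality, I splits off every larger member that avoids a.\<close>
  have splits: "Y \<in> \<T>" if Y: "I \<union> Y \<in> \<T>" "a \<notin> Y" "I \<inter> Y = {}" for Y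
  proof -
    obtain C where C: "I \<subseteq> C" "C \<subseteq> I \<union> Y" "good C" "(I \<union> Y) - C \<in> \<T>"
      using component[of "I \<union> Y" I] I Y unfolding good_def by auto
    have "I = C" using max[OF C(3)] C(1) by (intro card_seteq) auto
    then have "(I \<union> Y) - C = Y" using Y(3) by blast
    with C(4) show ?thesis by simp
  qed
  show thesis
  proof (rule that)
    show "I \<in> \<T>" "b \<in> I" "a \<notin> I" using I by (auto simp: good_def)
    fix A
    assume A: "b \<in> A" "A \<inter> I \<in> \<T>" "A \<union> I \<in> \<T>" "- A \<inter> I \<in> \<T>" "- A \<union> I \<in> \<T>"
    have "I - A \<inter> I = - A \<inter> I" by blast
    then have "A \<inter> I = I" using I A unfolding good_def indec_def by auto
    then have sub: "I \<subseteq> A" by blast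
    show "A = I \<or> A = UNIV"
    proof (cases "a \<in> A")
      case True
      have "- A \<in> \<T>"
        using splits[of "- A"] True sub A(5) by (metis Compl_iff Un_commute disjoint_eq_subset_Compl double_complement)
      moreover have "A \<in> \<T>" using A(3) sub by (simp add: sup_absorb1)
      ultimately show ?thesis using conn[of A] A(1) by blast
    next
      case False
      have "I \<union> (A - I) = A \<union> I" by blast
      then have "A - I \<in> \<T>" using splits[of "A - I"] False A(3) by auto
      moreover have "- (A - I) = - A \<union> I" by blast
      ultimately have "A - I = {} \<or> A - I = UNIV" using conn[of "A - I"] A(5) by simp
      then show ?thesis using sub A(1) I by (auto simp: good_def)
    qed
  qed
qed

text \<open>
  If the function on the other side of \<open>I\<close> decomposed along \<open>A\<close>, then \<open>A\<close> and
  its complement would be tight for it at \<open>q\<close>, hence their traces on \<open>I\<close> and their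
  unions with \<open>I\<close> would be tight for \<open>\<mu>\<close>. The choice of \<open>I\<close> leaves only
  \<open>A = I\<close>, and then the new function would equal the common splitting, which completeness
  rules out.
\<close>

lemma crosses_to_simple:
  fixes \<C> :: "('v::finite set \<Rightarrow> real) set"
  assumes C: "\<And>\<mu>. \<mu> \<in> \<C> \<Longrightarrow> supermodular \<mu> \<and> \<mu> UNIV = n"
    and comp: "complete_for \<C> \<Omega>" and "q \<in> \<Omega>" and \<mu>: "\<mu> \<in> \<C>" "simple \<mu>" "q \<in> base_polytope \<mu>"
    and I0: "slack \<mu> q I0 = 0" "b \<in> I0" "a \<notin> I0"
  obtains I \<mu>' where "slack \<mu> q I = 0" "b \<in> I" "a \<notin> I"
    "\<mu>' \<in> \<C>" "simple \<mu>'" "crosses \<mu> I \<mu>'" "q \<in> base_polytope \<mu>'"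
proof -
  note sm = C[OF \<mu>(1)]
  have nn: "slack \<mu> q UNIV = 0" "0 \<le> slack \<mu> q S" for S
    using \<mu>(3) mem_base_polytope_iff sm by blast+
  let ?T = "{S. slack \<mu> q S = 0}"
  have lat: "S \<union> U \<in> ?T" "S \<inter> U \<in> ?T" if "S \<in> ?T" "U \<in> ?T" for S U
    using slack_submodular[of \<mu> q S U] sm that nn(2)[of "S \<union> U"] nn(2)[of "S \<inter> U"] by auto
  have emp: "{} \<in> ?T" using slack_empty sm by auto
  have con: "S = {} \<or> S = UNIV" if "S \<in> ?T" "- S \<in> ?T" for S
    using that slack_Compl[of \<mu> q S] nn(1) \<mu>(2) unfolding simple_iff by auto
  obtain I where I: "I \<in> ?T" "b \<in> I" "a \<notin> I"
    and facet: "\<And>A. b \<in> A \<Longrightarrow> A \<inter> I \<in> ?T \<Longrightarrow> A \<union> I \<in> ?T \<Longrightarrow> - A \<inter> I \<in> ?T \<Longrightarrow> - A \<union> I \<in> ?T \<Longrightarrow>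
      A = I \<or> A = UNIV"
    using facet_set_exists[of ?T I0 b a] lat emp con I0 by auto
  have tI: "slack \<mu> q I = 0" "I \<noteq> {}" "I \<noteq> UNIV" using I by auto
  obtain \<mu>' where \<mu>': "\<mu>' \<in> \<C>" "crosses \<mu> I \<mu>'" "\<mu>' \<noteq> splitting \<mu> (I, - I)"
    using complete_forE[OF comp \<mu>(1) _ \<mu>(3) assms(3) tI] sm by blast
  note sm' = C[OF \<mu>'(1)]
  have q': "q \<in> base_polytope \<mu>'"
    using mem_base_polytope_crosses[of \<mu> \<mu>' I q] sm sm' \<mu>'(2) \<mu>(3) tI by auto
  have nn': "slack \<mu>' q UNIV = 0" "0 \<le> slack \<mu>' q S" for S
    using q' mem_base_polytope_iff sm' by blast+
  have "simple \<mu>'"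
  proof (rule ccontr)
    assume "\<not> simple \<mu>'"
    then obtain A0 where A0: "A0 \<noteq> {}" "A0 \<noteq> UNIV" "\<mu>' A0 + \<mu>' (- A0) = n"
      using sm' not_simpleE by metis
    define A where "A = (if b \<in> A0 then A0 else - A0)"
    have A: "A \<noteq> UNIV" "\<mu>' A + \<mu>' (- A) = n" "b \<in> A"
      using A0 by (auto simp: A_def add.commute)
    have z: "slack \<mu>' q A = 0" "slack \<mu>' q (- A) = 0"
      using slack_Compl[of \<mu>' q A] nn'(1) nn'(2)[of A] nn'(2)[of "- A"] A(2) sm' by linarith+
    have "S \<inter> I \<in> ?T \<and> S \<union> I \<in> ?T" if "slack \<mu>' q S = 0" for S
      using crosses_lower[of \<mu>' \<mu> I q S] sm' \<mu>'(2) that tI(1) nn(2)[of "S \<inter> I"] nn(2)[of "S \<union> I"]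
      by auto
    then have "A = I" using facet[of A] z A by blast
    then have "splitting \<mu>' (- I, I) = \<mu>'"
      using splitting_eq_self[of \<mu>' "- I" I] A(2) sm' by (simp add: add.commute)
    then show False using \<mu>'(2,3) by (simp add: crosses_def)
  qed
  then show thesis using that tI I \<mu>' q' by blast
qed

section \<open>Walks in root directions\<close>

abbreviation root :: "'v::finite \<Rightarrow> 'v \<Rightarrow> real ^ 'v" where
  "root a b \<equiv> axis a 1 - axis b 1"

lemma vec_sum_root:
  "vec_sum (x + t *\<^sub>R root a b) S = vec_sum x S + t * (of_bool (a \<in> S) - of_bool (b \<in> S))"
proof -
  have "(\<Sum>v\<in>S. axis c (1::real) $ v) = of_bool (c \<in> S)" for c
    by (simp add: axis_def of_bool_def)
  then show ?thesis
    by (simp add: vec_sum_def sum.distrib sum_subtractf sum_distrib_left[symmetric])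
qed

lemma slack_root:
  "slack \<mu> (x + t *\<^sub>R root a b) S = slack \<mu> x S + t * (of_bool (a \<in> S) - of_bool (b \<in> S))"
  by (simp add: slack_def vec_sum_root)

text \<open>
  Here \<open>s k\<close> and \<open>s (Suc k)\<close> are the times at which the walk enters and leaves the
  polytope of \<open>\<mu> k\<close>, and \<open>I k\<close> is the set whose face it crosses on leaving.
  Several crossings may happen at the same point.

  All slacks are taken at the limit point \<open>q\<close>. Seen from there, the set \<open>I k\<close> is
  violated by exactly the remaining time \<open>r k\<close>, and no set is violated by more. This extremality is
  what makes the two propagation steps free of error terms, so that windows of any length are allowed.
\<close>

lemma no_infinite_walk:
  fixes \<mu> :: "nat \<Rightarrow> 'v::finite set \<Rightarrow> real" and s :: "nat \<Rightarrow> real"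
  assumes sm: "\<And>k. supermodular (\<mu> k)" and rng: "\<And>k. \<mu> k UNIV = n"
    and "0 < \<epsilon>"
    and width: "\<And>k W. W \<noteq> {} \<Longrightarrow> W \<noteq> UNIV \<Longrightarrow> \<epsilon> \<le> n - \<mu> k W - \<mu> k (- W)"
    and inc: "\<And>k. s k \<le> s (Suc k)" and bound: "\<And>k. s k \<le> L"
    and mem: "\<And>k. x + s (Suc k) *\<^sub>R root a b \<in> base_polytope (\<mu> k)"
    and I: "\<And>k. b \<in> I k" "\<And>k. a \<notin> I k"
    and tight: "\<And>k. slack (\<mu> k) (x + s (Suc k) *\<^sub>R root a b) (I k) = 0"
    and cross: "\<And>k. crosses (\<mu> k) (I k) (\<mu> (Suc k))"
  shows False
proof -
  have "incseq s" using inc by (simp add: incseq_SucI)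
  then obtain t where lim: "s \<longlonglongrightarrow> t" and le: "\<And>k. s k \<le> t"
    using incseq_convergent[of s L] bound by blast
  define q where "q = x + t *\<^sub>R root a b"
  define D where "D k S = slack (\<mu> k) q S" for k S
  define r where "r k = t - s (Suc k)" for k
  have r0: "0 \<le> r k" for k using le by (simp add: r_def)
  have q: "q = (x + s (Suc k) *\<^sub>R root a b) + r k *\<^sub>R root a b" for k
    by (simp add: q_def r_def algebra_simps)
  have DS: "D k S = slack (\<mu> k) (x + s (Suc k) *\<^sub>R root a b) S
      + r k * (of_bool (a \<in> S) - of_bool (b \<in> S))" for k S
    unfolding D_def by (subst q[of k], subst slack_root) simp
  have nn: "slack (\<mu> k) (x + s (Suc k) *\<^sub>R root a b) UNIV = 0"
     "0 \<le> slack (\<mu> k) (x + s (Suc k) *\<^sub>R root a b) S" for k S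
    using mem mem_base_polytope_iff sm by blast+
  have DU: "D k UNIV = 0" for k using DS nn by simp
  have D_ge: "- r k \<le> D k S" for k S
    using DS[of k S] nn(2)[of k S] r0[of k] by (auto simp: of_bool_def split: if_splits)
  have D_ge0: "0 \<le> D k S" if "a \<in> S" for k S
    using DS[of k S] nn(2)[of k S] r0[of k] that by (auto simp: of_bool_def split: if_splits)
  have DI: "D k (I k) = - r k" for k
    using DS[of k "I k"] tight I by simp
  have lower: "D k (S \<inter> I k) + D k (S \<union> I k) - D k (I k) \<le> D (Suc k) S" for k S
    unfolding D_def by (rule crosses_lower[OF sm cross])
  have eq: "D (Suc k) (S \<union> - I k) = D k S - D k (I k)" if "S \<subseteq> I k" for k S
    unfolding D_def using DU that by (intro crosses_eq) (auto simp: sm rng cross D_def)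
  \<comment> \<open>Backwards: in the bound for S \<inter> I k the violation r k of I k pays for that of S \<union> I k.\<close>
  have D_inter: "D k (\<Inter>i\<in>{..j}. I (k + i)) \<le> 0" for k j
  proof (induction j arbitrary: k)
    case 0
    then show ?case using DI[of k] r0[of k] by simp
  next
    case (Suc j)
    let ?S = "\<Inter>i\<in>{..j}. I (Suc k + i)"
    have "(\<Inter>i\<in>{..Suc j}. I (k + i)) = ?S \<inter> I k"
      by (simp add: atMost_Suc_eq_insert_0 image_image Int_commute)
    then show ?case
      using lower[of k ?S] Suc[of "Suc k"] DI[of k] D_ge[of k "?S \<union> I k"] by simp
  qed
  \<comment> \<open>Forwards: the unions contain a, so together with I k they contain both a and b, and
      such sets are not violated at all.\<close>
  have D_union: "D (Suc (k + j)) (\<Union>i\<in>{..j}. - I (k + i)) \<le> r k" for k j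
  proof (induction j)
    case 0
    then show ?case using eq[of "{}" k] DI[of k] by (simp add: D_def slack_empty sm)
  next
    case (Suc j)
    let ?m = "Suc (k + j)" let ?S = "\<Union>i\<in>{..j}. - I (k + i)"
    have a: "a \<in> ?S" using I by blast
    have "(\<Union>i\<in>{..Suc j}. - I (k + i)) = (?S \<inter> I ?m) \<union> - I ?m"
      by (auto simp: atMost_Suc)
    then have "D (Suc ?m) (\<Union>i\<in>{..Suc j}. - I (k + i)) = D ?m (?S \<inter> I ?m) - D ?m (I ?m)"
      using eq[of "?S \<inter> I ?m" ?m] by simp
    also have "\<dots> \<le> D ?m ?S - D ?m (?S \<union> I ?m)"
      using slack_submodular[OF sm, of ?m q ?S "I ?m"] by (simp add: D_def)
    also have "\<dots> \<le> D ?m ?S" using D_ge0[of "?S \<union> I ?m" ?m] a by simp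
    finally show ?case using Suc by simp
  qed
  define W where "W = {v. eventually (\<lambda>k. v \<in> I k) sequentially}"
  have "eventually (\<lambda>k. \<forall>v\<in>W. v \<in> I k) sequentially"
    by (subst eventually_ball_finite_distrib) (auto simp: W_def)
  moreover have "eventually (\<lambda>k. t - \<epsilon> < s k) sequentially"
    using order_tendstoD(1)[OF lim, of "t - \<epsilon>"] \<open>0 < \<epsilon>\<close> by simp
  ultimately obtain N where N: "\<And>k. N \<le> k \<Longrightarrow> W \<subseteq> I k" "\<And>k. N \<le> k \<Longrightarrow> t - \<epsilon> < s k"
    unfolding eventually_sequentially by (metis (no_types, lifting) nat_le_linear order_trans subsetI)
  have W_inter: "\<exists>j. (\<Inter>i\<in>{..j}. I (k + i)) = W" if "N \<le> k" for k
  proof -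
    have "\<exists>i. v \<notin> I (k + i)" if "v \<notin> W" for v
      using that unfolding W_def eventually_sequentially by (auto simp: le_iff_add)
    then obtain f where f: "\<And>v. v \<notin> W \<Longrightarrow> v \<notin> I (k + f v)" by metis
    have "(\<Inter>i\<in>{..Max (range f)}. I (k + i)) \<subseteq> W"
    proof
      fix v
      assume v: "v \<in> (\<Inter>i\<in>{..Max (range f)}. I (k + i))"
      have "f v \<le> Max (range f)" by simp
      then show "v \<in> W" using v f[of v] by blast
    qed
    moreover have "W \<subseteq> (\<Inter>i\<in>{..Max (range f)}. I (k + i))"
      using N(1) \<open>N \<le> k\<close> by (simp add: le_INF_iff)
    ultimately show ?thesis by blast
  qed
  \<comment> \<open>One window from N forwards makes the complement of W almost tight; a second window,
      starting where the first ends, makes W tight for the same function.\<close>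
  obtain j where j: "(\<Inter>i\<in>{..j}. I (N + i)) = W" using W_inter by blast
  then have cW: "(\<Union>i\<in>{..j}. - I (N + i)) = - W" by blast
  define m where "m = Suc (N + j)"
  obtain j' where j': "(\<Inter>i\<in>{..j'}. I (m + i)) = W" using W_inter[of m] by (auto simp: m_def)
  have "b \<in> W" "a \<notin> W" using j I by blast+
  then have "\<epsilon> \<le> n - \<mu> m W - \<mu> m (- W)" using width by blast
  also have "\<dots> = D m W + D m (- W)"
    using slack_Compl[of "\<mu> m" q W] DU[of m] by (simp add: D_def rng)
  also have "\<dots> \<le> r N"
    using D_inter[of m j'] D_union[of N j] unfolding j' cW m_def[symmetric] by simp
  also have "\<dots> < \<epsilon>" using N(2)[of "Suc N"] by (simp add: r_def)
  finally show False by simp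
qed

text \<open>
  If the end of the segment were missed, each exit time would be less than \<open>L\<close>, and the
  crossings could be continued for ever.
\<close>

lemma support_root_move:
  fixes \<C> :: "('v::finite set \<Rightarrow> real) set"
  assumes C: "\<And>\<mu>. \<mu> \<in> \<C> \<Longrightarrow> supermodular \<mu> \<and> \<mu> UNIV = n"
    and comp: "complete_for \<C> \<Omega>" and pos: "positive_family \<C>" and "a \<noteq> b" "0 \<le> L"
    and \<Omega>: "\<And>t. 0 \<le> t \<Longrightarrow> t \<le> L \<Longrightarrow> x + t *\<^sub>R root a b \<in> \<Omega>"
    and x: "x \<in> support \<C>"
  shows "x + L *\<^sub>R root a b \<in> support \<C>"
proof (rule ccontr)
  assume not: "x + L *\<^sub>R root a b \<notin> support \<C>"
  let ?y = "\<lambda>t. x + t *\<^sub>R root a b"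
  define state where "state p \<longleftrightarrow> fst p \<in> \<C> \<and> simple (fst p) \<and> 0 \<le> snd p \<and> snd p \<le> L \<and>
    ?y (snd p) \<in> base_polytope (fst p)" for p
  define step where "step p p' \<longleftrightarrow> snd p \<le> snd p' \<and> ?y (snd p') \<in> base_polytope (fst p) \<and>
    (\<exists>I. b \<in> I \<and> a \<notin> I \<and> slack (fst p) (?y (snd p')) I = 0 \<and> crosses (fst p) I (fst p'))" for p p'
  have init: "\<exists>p. state p"
  proof -
    obtain \<mu> where "\<mu> \<in> \<C>" "x \<in> base_polytope \<mu>" using x by (auto simp: support_def)
    moreover have "x \<in> \<Omega>" using \<Omega>[of 0] \<open>0 \<le> L\<close> by simp
    ultimately obtain \<nu> where "\<nu> \<in> \<C>" "simple \<nu>" "x \<in> base_polytope \<nu>"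
      using mem_simple_base_polytope[OF C comp] by blast
    then have "state (\<nu>, 0)" using \<open>0 \<le> L\<close> by (simp add: state_def)
    then show ?thesis by blast
  qed
  have next_state: "\<exists>p'. state p' \<and> step p p'" if st: "state p" for p
  proof -
    obtain \<mu> s where p: "p = (\<mu>, s)" by force
    have \<mu>: "\<mu> \<in> \<C>" "simple \<mu>" "0 \<le> s" "s \<le> L" "?y s \<in> base_polytope \<mu>"
      using st by (auto simp: state_def p)
    note sm = C[OF \<mu>(1)]
    have nn: "slack \<mu> (?y s) UNIV = 0" "0 \<le> slack \<mu> (?y s) S" for S
      using \<mu>(5) mem_base_polytope_iff sm by blast+
    let ?F = "{S. b \<in> S \<and> a \<notin> S}"
    let ?V = "slack \<mu> (?y s) ` ?F"
    have "{b} \<in> ?F" using \<open>a \<noteq> b\<close> by simp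
    then have "slack \<mu> (?y s) {b} \<in> ?V" by (rule imageI)
    then have V: "finite ?V" "?V \<noteq> {}" by (simp, metis empty_iff)
    \<comment> \<open>The motion lowers only the slacks of the sets in the family just considered, all at unit rate, so
      the walk stays in the polytope exactly until the smallest of them is used up.\<close>
    define \<tau> where "\<tau> = Min ?V"
    obtain I0 where I0: "b \<in> I0" "a \<notin> I0" "slack \<mu> (?y s) I0 = \<tau>"
      using Min_in[OF V] unfolding \<tau>_def[symmetric] by auto
    have \<tau>_le: "\<tau> \<le> slack \<mu> (?y s) S" if "b \<in> S" "a \<notin> S" for S
      unfolding \<tau>_def using V that by (intro Min_le) auto
    have "0 \<le> \<tau>" using I0 nn by metis
    have shift: "slack \<mu> (?y (s + u)) S
        = slack \<mu> (?y s) S + u * (of_bool (a \<in> S) - of_bool (b \<in> S))" for u S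
      using slack_root[of \<mu> "?y s" u a b S] by (simp add: algebra_simps)
    have inside: "?y (s + u) \<in> base_polytope \<mu>" if "0 \<le> u" "u \<le> \<tau>" for u
    proof -
      have "0 \<le> slack \<mu> (?y (s + u)) S" for S
        using shift[of u S] nn(2)[of S] \<tau>_le[of S] that by (cases "a \<in> S"; cases "b \<in> S") auto
      moreover have "slack \<mu> (?y (s + u)) UNIV = 0" using shift[of u UNIV] nn by simp
      ultimately show ?thesis using mem_base_polytope_iff sm by blast
    qed
    have "s + \<tau> < L"
    proof (rule ccontr)
      assume "\<not> s + \<tau> < L"
      then have "?y (s + (L - s)) \<in> base_polytope \<mu>" using \<mu>(4) by (intro inside) auto
      with \<mu>(1) not show False by (auto simp: support_def)
    qed
    have y: "?y (s + \<tau>) \<in> \<Omega>" "?y (s + \<tau>) \<in> base_polytope \<mu>" "slack \<mu> (?y (s + \<tau>)) I0 = 0"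
      using \<Omega>[of "s + \<tau>"] \<open>s + \<tau> < L\<close> \<open>0 \<le> \<tau>\<close> \<mu>(3) inside[of \<tau>] shift[of \<tau> I0] I0 by auto
    obtain I \<mu>' where I: "slack \<mu> (?y (s + \<tau>)) I = 0" "b \<in> I" "a \<notin> I"
      "\<mu>' \<in> \<C>" "simple \<mu>'" "crosses \<mu> I \<mu>'" "?y (s + \<tau>) \<in> base_polytope \<mu>'"
      using crosses_to_simple[OF C comp y(1) \<mu>(1,2) y(2,3) I0(1,2)] by blast
    have "state (\<mu>', s + \<tau>)" using I \<mu>(3) \<open>0 \<le> \<tau>\<close> \<open>s + \<tau> < L\<close> by (simp add: state_def)
    moreover have "step p (\<mu>', s + \<tau>)" using I \<open>0 \<le> \<tau>\<close> y by (auto simp: step_def p)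
    ultimately show ?thesis by blast
  qed
  obtain p where p: "\<And>k. state (p k)" "\<And>k. step (p k) (p (Suc k))"
    using dependent_nat_choice[of "\<lambda>_. state" "\<lambda>_. step"] init next_state by metis
  then have "\<forall>k. \<exists>I. b \<in> I \<and> a \<notin> I \<and> slack (fst (p k)) (?y (snd (p (Suc k)))) I = 0 \<and>
      crosses (fst (p k)) I (fst (p (Suc k)))"
    by (simp add: step_def)
  then obtain I where I: "\<And>k. b \<in> I k" "\<And>k. a \<notin> I k"
    "\<And>k. slack (fst (p k)) (?y (snd (p (Suc k)))) (I k) = 0"
    "\<And>k. crosses (fst (p k)) (I k) (fst (p (Suc k)))"
    by metis
  obtain \<epsilon> where \<epsilon>: "0 < \<epsilon>" "\<And>\<mu> W. \<mu> \<in> \<C> \<Longrightarrow> simple \<mu> \<Longrightarrow> W \<noteq> {} \<Longrightarrow> W \<noteq> UNIV \<Longrightarrow>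
      \<epsilon> \<le> \<mu> UNIV - \<mu> W - \<mu> (- W)"
    using positive_family_width[OF _ pos] C by blast
  have inC: "fst (p k) \<in> \<C>" "simple (fst (p k))" for k using p(1) by (auto simp: state_def)
  show False
  proof (rule no_infinite_walk[of "\<lambda>k. fst (p k)" n \<epsilon> "\<lambda>k. snd (p k)" L x a b I])
    fix k W
    assume "W \<noteq> {}" "W \<noteq> (UNIV :: 'v set)"
    then show "\<epsilon> \<le> n - fst (p k) W - fst (p k) (- W)"
      using \<epsilon>(2)[OF inC, of W k] C[OF inC(1), of k] by simp
  qed (use p I inC C \<epsilon>(1) in \<open>auto simp: state_def step_def\<close>)
qed

section \<open>From root moves to connected regions\<close>

text \<open>
  A vector \<open>w\<close> with coordinate sum zero is the sum of the vectors
  \<open>w $ v *\<^sub>R root v c\<close> for a fixed coordinate \<open>c\<close>. Each of them is a root move,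
  from \<open>c\<close> to \<open>v\<close> or back according to the sign of \<open>w $ v\<close>, and no partial sum
  is longer than \<open>2 * CARD('v) * norm w\<close>, so the zigzag stays in the ball.
\<close>

lemma root_path:
  fixes P :: "real ^ 'v::finite \<Rightarrow> bool"
  assumes move: "\<And>x a b L. a \<noteq> b \<Longrightarrow> 0 \<le> L \<Longrightarrow> P x \<Longrightarrow>
      (\<And>t. 0 \<le> t \<Longrightarrow> t \<le> L \<Longrightarrow> x + t *\<^sub>R root a b \<in> \<Omega>) \<Longrightarrow> P (x + L *\<^sub>R root a b)"
    and ball: "ball y \<rho> \<inter> sum_hyperplane n \<subseteq> \<Omega>"
    and z: "z \<in> sum_hyperplane n" "z' \<in> sum_hyperplane n"
    and near: "norm (z - y) + 2 * real CARD('v) * norm (z' - z) < \<rho>"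
    and "P z"
  shows "P z'"
proof -
  obtain c :: 'v where "c \<in> UNIV" by blast
  define w where "w = z' - z"
  define pt where "pt F = z + (\<Sum>v\<in>F. w $ v *\<^sub>R root v c)" for F
  have axis_norm: "norm (root v c) \<le> 2" for v
    using norm_triangle_ineq4[of "axis v (1::real)" "axis c 1"] by (simp add: norm_axis_1)
  have sum_w: "(\<Sum>v\<in>UNIV. w $ v) = 0"
    using z by (simp add: w_def sum_subtractf sum_hyperplane_def)
  have pt_end: "pt UNIV = z'"
  proof -
    have "(\<Sum>v\<in>UNIV. w $ v *\<^sub>R root v c) = (\<Sum>v\<in>UNIV. w $ v *\<^sub>R axis v 1) - (\<Sum>v\<in>UNIV. w $ v) *\<^sub>R axis c 1"
      by (simp add: scaleR_diff_right sum_subtractf scaleR_left.sum)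
    also have "(\<Sum>v\<in>UNIV. w $ v *\<^sub>R axis v 1) = w"
      using basis_expansion[of w] by (simp add: scalar_mult_eq_scaleR)
    finally show ?thesis using sum_w by (simp add: pt_def w_def)
  qed
  have near_pt: "pt F \<in> ball y \<rho>" for F
  proof -
    have "norm (\<Sum>v\<in>F. w $ v *\<^sub>R root v c) \<le> (\<Sum>v\<in>F. norm w * 2)"
      by (intro sum_norm_le) (simp add: axis_norm component_le_norm_cart mult_mono)
    also have "\<dots> = real (card F) * (norm w * 2)" by simp
    also have "\<dots> \<le> real CARD('v) * (norm w * 2)"
      by (intro mult_right_mono) (simp_all add: card_mono)
    finally have "norm (\<Sum>v\<in>F. w $ v *\<^sub>R root v c) \<le> 2 * real CARD('v) * norm w" by simp
    then have "norm (pt F - y) < \<rho>"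
      using near norm_triangle_ineq[of "z - y" "\<Sum>v\<in>F. w $ v *\<^sub>R root v c"]
      by (simp add: pt_def w_def algebra_simps)
    then show ?thesis by (simp add: dist_norm norm_minus_commute)
  qed
  have H_root: "u + t *\<^sub>R root v v' \<in> sum_hyperplane n" if "u \<in> sum_hyperplane n" for u t v v'
    using that vec_sum_root[of u t v v' UNIV] by (simp add: sum_hyperplane_def vec_sum_def)
  have "P (pt F) \<and> pt F \<in> sum_hyperplane n" for F :: "'v set"
    using finite[of F]
  proof (induction F rule: finite_induct)
    case empty
    then show ?case using \<open>P z\<close> z by (simp add: pt_def)
  next
    case (insert v F)
    have eq: "pt (insert v F) = pt F + (w $ v) *\<^sub>R root v c"
      using insert by (simp add: pt_def)
    show ?case
    proof (cases "v = c")
      case True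
      then show ?thesis using insert eq by simp
    next
      case False
      define p where "p = (if 0 \<le> w $ v then v else c)"
      define p' where "p' = (if 0 \<le> w $ v then c else v)"
      have eq': "pt (insert v F) = pt F + \<bar>w $ v\<bar> *\<^sub>R root p p'"
        using eq by (simp add: p_def p'_def algebra_simps)
      have "P (pt F + \<bar>w $ v\<bar> *\<^sub>R root p p')"
      proof (rule move)
        show "p \<noteq> p'" using False by (simp add: p_def p'_def)
        fix t
        assume t: "0 \<le> t" "t \<le> \<bar>w $ v\<bar>"
        define \<theta> where "\<theta> = t / \<bar>w $ v\<bar>"
        have \<theta>: "0 \<le> \<theta>" "\<theta> \<le> 1" "t = \<theta> * \<bar>w $ v\<bar>"
          using t by (auto simp: \<theta>_def divide_le_eq_1)
        have "(1 - \<theta>) *\<^sub>R pt F + \<theta> *\<^sub>R pt (insert v F) \<in> ball y \<rho>"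
          using \<theta> near_pt by (intro convexD_alt convex_ball) auto
        also have "(1 - \<theta>) *\<^sub>R pt F + \<theta> *\<^sub>R pt (insert v F) = pt F + t *\<^sub>R root p p'"
          unfolding eq' \<theta>(3) by (simp add: algebra_simps)
        finally show "pt F + t *\<^sub>R root p p' \<in> \<Omega>"
          using ball H_root insert by blast
      qed (use insert in auto)
      then show ?thesis using eq' H_root insert by auto
    qed
  qed
  then show ?thesis using pt_end by metis
qed

theorem theorem3p8:
  fixes n :: real
    and \<C> :: "('v::finite set \<Rightarrow> real) set"
    and \<Omega> :: "(real ^ 'v) set"
  assumes "\<And>\<mu>. \<mu> \<in> \<C> \<Longrightarrow> supermodular \<mu> \<and> range_val \<mu> = n"
    and "openin (top_of_set (sum_hyperplane n)) \<Omega>"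
    and "connected \<Omega>"
    and "support \<C> \<inter> \<Omega> \<noteq> {}"
    and "complete_for \<C> \<Omega>"
    and "positive_family \<C>"
  shows "\<Omega> \<subseteq> support \<C>"
proof
  fix y
  assume "y \<in> \<Omega>"
  obtain x where x: "x \<in> support \<C>" "x \<in> \<Omega>" using assms(4) by blast
  have C: "supermodular \<mu> \<and> \<mu> UNIV = n" if "\<mu> \<in> \<C>" for \<mu>
    using assms(1)[OF that] by (simp add: range_val_def)
  have H: "\<Omega> \<subseteq> sum_hyperplane n" using assms(2) openin_imp_subset by blast
  show "y \<in> support \<C>"
  proof (rule connected_induction_simple[OF assms(3) x(2) \<open>y \<in> \<Omega>\<close>, of "\<lambda>u. u \<in> support \<C>"])
    fix u
    assume u: "u \<in> \<Omega>"
    obtain \<rho> where \<rho>: "0 < \<rho>" "ball u \<rho> \<inter> sum_hyperplane n \<subseteq> \<Omega>"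
      using assms(2) u unfolding openin_contains_ball by blast
    \<comment> \<open>Two points of the smaller ball are less than 2 \<delta> apart, and the zigzag between them strays
      from the first by at most 2 CARD('v) times that.\<close>
    define \<delta> where "\<delta> = \<rho> / (1 + 4 * real CARD('v))"
    have \<delta>: "0 < \<delta>" "\<delta> + 4 * real CARD('v) * \<delta> = \<rho>"
    proof -
      have pos: "0 < 1 + 4 * real CARD('v)" by (simp add: add_pos_nonneg)
      show "0 < \<delta>" using \<rho>(1) pos by (simp add: \<delta>_def)
      have "\<delta> + 4 * real CARD('v) * \<delta> = (1 + 4 * real CARD('v)) * \<delta>" by (simp add: distrib_right)
      also have "\<dots> = \<rho>" using pos by (simp add: \<delta>_def)
      finally show "\<delta> + 4 * real CARD('v) * \<delta> = \<rho>" .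
    qed
    show "\<exists>T. openin (top_of_set \<Omega>) T \<and> u \<in> T \<and>
        (\<forall>z\<in>T. \<forall>z'\<in>T. z \<in> support \<C> \<longrightarrow> z' \<in> support \<C>)"
    proof (intro exI[of _ "\<Omega> \<inter> ball u \<delta>"] conjI ballI impI)
      show "u \<in> \<Omega> \<inter> ball u \<delta>" using u \<delta> by simp
      fix z z'
      assume z: "z \<in> \<Omega> \<inter> ball u \<delta>" "z' \<in> \<Omega> \<inter> ball u \<delta>" and "z \<in> support \<C>"
      have "norm (z - u) < \<delta>" using z by (simp add: dist_norm norm_minus_commute)
      moreover have "norm (z' - z) \<le> 2 * \<delta>"
        using z dist_triangle2[of z' z u] by (simp add: dist_norm norm_minus_commute)
      then have "2 * real CARD('v) * norm (z' - z) \<le> 2 * real CARD('v) * (2 * \<delta>)"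
        by (intro mult_left_mono) auto
      ultimately have near: "norm (z - u) + 2 * real CARD('v) * norm (z' - z) < \<rho>"
        using \<delta>(2) by linarith
      show "z' \<in> support \<C>"
      proof (rule root_path[where P = "\<lambda>v. v \<in> support \<C>", OF _ \<rho>(2) _ _ near \<open>z \<in> support \<C>\<close>])
        show "z \<in> sum_hyperplane n" "z' \<in> sum_hyperplane n" using z H by auto
      qed (rule support_root_move[OF C assms(5,6)])
    qed auto
  qed (use x in auto)
qed

end
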